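(* For every integer $n\ge 0$, $$\sum_{k=0}^{n}\binom{2n}{2k}B_{2,2n-2k}\,B_{2,2k}=\frac14\left[\delta_{2n-2}+2n\,B_{2,2n-1}-(2n-4)\,B_{2,2n}\right].$$
   Context: The hypergeometric Bernoulli numbers $B_{2,n}$ of order $2$ are defined by $$\frac{t^2/2}{e^t-1-t}=\sum_{n=0}^\infty B_{2,n}\frac{t^n}{n!},$$ with $B_{2,n}=0$ for $n<0$. $\delta_m$ equals $1$ if $m=0$ and $0$ otherwise. *)

theory Defs
  imports Complex_Main "HOL-Computational_Algebra.Formal_Power_Series"
begin

definition hyp_bernoulli2_gf :: "real fps" where
  "hyp_bernoulli2_gf = (fps_const (1/2) * fps_X ^ 2) / (fps_exp 1 - 1 - fps_X)"

(* Division of formal power series is total; this confirms that the quotient above is exact. *)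
lemma hyp_bernoulli2_gf_mult:
  "hyp_bernoulli2_gf * (fps_exp 1 - 1 - fps_X) = fps_const (1/2) * fps_X ^ 2"
proof -
  let ?g = "fps_exp 1 - 1 - fps_X :: real fps"
  have nth: "fps_nth ?g 0 = 0" "fps_nth ?g 1 = 0" "fps_nth ?g 2 \<noteq> 0"
    by (simp_all add: fps_X_def)
  then have nz: "?g \<noteq> 0" by force
  have sub: "subdegree ?g = 2"
    using nth by (intro subdegreeI) (auto simp: less_2_cases_iff)
  have "?g dvd fps_const (1/2) * fps_X ^ 2"
    using nz sub by (subst fps_dvd_iff) auto
  then show ?thesis
    unfolding hyp_bernoulli2_gf_def by (rule dvd_div_mult_self)
qed

definition hyp_bernoulli2 :: "int \<Rightarrow> real" where
  "hyp_bernoulli2 n =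
     (if n < 0 then 0 else fact (nat n) * fps_nth hyp_bernoulli2_gf (nat n))"

definition kdelta :: "int \<Rightarrow> real" where
  "kdelta m = (if m = 0 then 1 else 0)"

end

theory Submission
  imports Defs
begin

text \<open>
  Write \<open>F\<close> for the generating function and \<open>G\<close> for \<open>F(-t)\<close>. Since \<open>1 + (-1)^j\<close> kills the odd
  \<open>j\<close>, the sum in the theorem is half of \<open>(2n)!\<close> times the coefficient of \<open>t^(2n)\<close> in
  \<open>F\<^sup>2 + G F\<close>, and both products turn out to be linear in \<open>F\<close>, \<open>F'\<close> and \<open>G\<close>.

  For \<open>F\<^sup>2\<close>, differentiating \<open>F (e^t - 1 - t) = t\<^sup>2/2\<close> brings in \<open>F (e^t - 1)\<close>, which the same
  equation rewrites as \<open>t\<^sup>2/2 + t F\<close>; multiplying by \<open>F\<close> once more removes the exponential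
  (\<open>hyp_bernoulli2_gf_square\<close>). For \<open>G F\<close>, the exponentials are removed instead by
  \<open>e^t e^(-t) = 1\<close> (\<open>hyp_bernoulli2_gf_mult_reflect\<close>). Comparing even coefficients gives the
  formula; the Kronecker delta comes from the summand \<open>t\<^sup>2/4\<close> in \<open>G F\<close>.
\<close>

text \<open>
  Adding \<open>f(-t) f(t)\<close> to \<open>f(t)\<^sup>2\<close> cancels the terms of the convolution that have an odd index.
\<close>

lemma fps_nth_even_convolution:
  fixes f :: "'a::comm_ring_1 fps"
  shows "fps_nth (f * f + (f oo - fps_X) * f) (2 * n) =
    2 * (\<Sum>k=0..n. fps_nth f (2 * k) * fps_nth f (2 * n - 2 * k))"
proof -
  let ?h = "\<lambda>j. (1 + (-1) ^ j) * (fps_nth f j * fps_nth f (2 * n - j))"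
  have "fps_nth (f * f + (f oo - fps_X) * f) (2 * n) =
      (\<Sum>j=0..2*n. fps_nth f j * fps_nth f (2 * n - j) +
        (-1) ^ j * fps_nth f j * fps_nth f (2 * n - j))"
    by (simp only: fps_add_nth fps_mult_nth fps_compose_uminus' fps_nth_Abs_fps sum.distrib)
  also have "\<dots> = (\<Sum>j=0..2*n. ?h j)"
    by (simp add: ring_distribs mult.assoc)
  also have "\<dots> = (\<Sum>j\<in>(\<lambda>k. 2 * k) ` {0..n}. ?h j)"
  proof (rule sum.mono_neutral_right)
    show "\<forall>j\<in>{0..2 * n} - (\<lambda>k. 2 * k) ` {0..n}. ?h j = 0"
    proof
      fix j assume j: "j \<in> {0..2 * n} - (\<lambda>k. 2 * k) ` {0..n}"
      have "odd j"
        using j by (auto elim!: evenE)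
      then show "?h j = 0" by simp
    qed
  qed auto
  also have "\<dots> = (\<Sum>k=0..n. ?h (2 * k))"
    by (subst sum.reindex) (auto simp: inj_on_def)
  also have "\<dots> = 2 * (\<Sum>k=0..n. fps_nth f (2 * k) * fps_nth f (2 * n - 2 * k))"
    by (simp add: sum_distrib_left)
  finally show ?thesis .
qed

text \<open>
  Differentiation of the defining equation yields a Riccati equation: besides \<open>F'\<close> times
  \<open>e^t - 1 - t\<close> there is \<open>F (e^t - 1) = t\<^sup>2/2 + t F\<close>, so multiplication by \<open>F\<close> leaves no
  exponential. A factor \<open>t\<close> cancels.
\<close>

lemma hyp_bernoulli2_gf_square:
  "hyp_bernoulli2_gf * hyp_bernoulli2_gf =
     hyp_bernoulli2_gf - fps_const (1/2) * (fps_X * hyp_bernoulli2_gf)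
       - fps_const (1/2) * (fps_X * fps_deriv hyp_bernoulli2_gf)"
proof -
  define F where "F = hyp_bernoulli2_gf"
  define D where "D = fps_deriv F"
  define E where "E = (fps_exp 1 :: real fps)"
  define c where "c = (fps_const (1/2) :: real fps)"
  define X where "X = (fps_X :: real fps)"
  have eq: "F * (E - 1 - X) = c * X ^ 2"
    using hyp_bernoulli2_gf_mult by (simp add: F_def E_def X_def c_def)
  have "fps_deriv (F * (E - 1 - X)) = fps_deriv (c * X ^ 2)"
    by (simp only: eq)
  moreover have "fps_deriv (F * (E - 1 - X)) = D * (E - 1 - X) + F * (E - 1)"
    by (simp add: D_def E_def X_def)
  moreover have "fps_deriv (c * X ^ 2) = X"
    by (rule fps_ext) (simp add: c_def X_def fps_X_power_nth fps_X_nth)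
  ultimately have deriv: "D * (E - 1 - X) + F * (E - 1) = X"
    by simp
  have "D * (F * (E - 1 - X)) + F * (F * (E - 1)) = F * (D * (E - 1 - X) + F * (E - 1))"
    by (simp add: algebra_simps)
  also have "\<dots> = F * X"
    by (simp only: deriv)
  finally have "D * (F * (E - 1 - X)) + F * (F * (E - 1)) = F * X" .
  moreover have "F * (E - 1) = c * X ^ 2 + X * F"
    using eq by (simp add: algebra_simps)
  ultimately have "D * (c * X ^ 2) + F * (c * X ^ 2 + X * F) = F * X"
    by (simp only: eq)
  then have "X * (F * F) = X * (F - c * (X * F) - c * (X * D))"
    by (simp add: algebra_simps power2_eq_square)
  moreover have "X \<noteq> 0"
    by (simp add: X_def)
  ultimately show ?thesis
    by (simp add: F_def D_def X_def c_def)
qed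

text \<open>
  Put \<open>a = e^t - 1 - t\<close> and \<open>b = e^(-t) - 1 + t\<close>. Then \<open>(a + 1 + t) (b + 1 - t) = 1\<close> expresses
  \<open>a b\<close> linearly in \<open>a\<close> and \<open>b\<close>; multiplying by \<open>F(t) F(-t)\<close> and cancelling \<open>t\<^sup>2\<close> gives the claim.
\<close>

lemma hyp_bernoulli2_gf_mult_reflect:
  "(hyp_bernoulli2_gf oo - fps_X) * hyp_bernoulli2_gf =
     fps_const (1/4) * fps_X ^ 2
       + fps_const (1/2) * ((hyp_bernoulli2_gf oo - fps_X) - fps_X * (hyp_bernoulli2_gf oo - fps_X))
       + fps_const (1/2) * (hyp_bernoulli2_gf + fps_X * hyp_bernoulli2_gf)"
proof -
  define F where "F = hyp_bernoulli2_gf"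
  define G where "G = F oo - fps_X"
  define E where "E = (fps_exp 1 :: real fps)"
  define E' where "E' = (fps_exp (-1) :: real fps)"
  define c where "c = (fps_const (1/2) :: real fps)"
  define X where "X = (fps_X :: real fps)"
  have eq: "F * (E - 1 - X) = c * X ^ 2"
    using hyp_bernoulli2_gf_mult by (simp add: F_def E_def X_def c_def)
  have "(E - 1 - X) oo - fps_X = E' - 1 + X"
    by (simp add: E_def E'_def X_def fps_compose_sub_distrib)
  moreover have "(c * X ^ 2) oo - fps_X = c * X ^ 2"
    by (simp add: c_def X_def fps_compose_mult_distrib power2_eq_square)
  moreover have "(F * (E - 1 - X)) oo - fps_X = G * ((E - 1 - X) oo - fps_X)"
    unfolding G_def by (rule fps_compose_mult_distrib) simp
  ultimately have eq': "G * (E' - 1 + X) = c * X ^ 2"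
    by (simp only: eq)
  have inv: "E * E' = 1"
    unfolding E_def E'_def by (simp flip: fps_exp_add_mult)
  define a where "a = E - 1 - X"
  define b where "b = E' - 1 + X"
  have "(a + (1 + X)) * (b + (1 - X)) = 1"
    using inv by (simp add: a_def b_def)
  then have ab: "X ^ 2 = a * b + a * (1 - X) + b * (1 + X)"
    by (simp add: algebra_simps power2_eq_square)
  have Fa: "F * a = c * X ^ 2" and Gb: "G * b = c * X ^ 2"
    using eq eq' by (simp_all add: a_def b_def)
  have "X ^ 2 * (G * F) = (F * a) * (G * b) + G * (1 - X) * (F * a) + F * (1 + X) * (G * b)"
    unfolding ab by (simp add: algebra_simps)
  also have "\<dots> = X ^ 2 * (c * c * X ^ 2 + c * (G - X * G) + c * (F + X * F))"
    unfolding Fa Gb by (simp add: algebra_simps power2_eq_square)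
  finally have "X ^ 2 * (G * F) = X ^ 2 * (c * c * X ^ 2 + c * (G - X * G) + c * (F + X * F))" .
  moreover have "X ^ 2 \<noteq> 0"
    by (simp add: X_def)
  moreover have "c * c = fps_const (1/4)"
    by (simp add: c_def)
  ultimately show ?thesis
    by (simp add: F_def G_def X_def c_def)
qed

theorem corollary11:
  fixes n :: nat
  shows "(\<Sum>k=0..n. real ((2 * n) choose (2 * k))
            * hyp_bernoulli2 (2 * int n - 2 * int k) * hyp_bernoulli2 (2 * int k))
       = 1/4 * (kdelta (2 * int n - 2)
                + 2 * real n * hyp_bernoulli2 (2 * int n - 1)
                - (2 * real n - 4) * hyp_bernoulli2 (2 * int n))"
proof -
  let ?F = hyp_bernoulli2_gf
  let ?N = "fact (2 * n) :: real"
  have B: "hyp_bernoulli2 (int m) = fact m * fps_nth ?F m" for m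
    by (simp add: hyp_bernoulli2_def)
  have term_eq: "real ((2 * n) choose (2 * k))
        * hyp_bernoulli2 (2 * int n - 2 * int k) * hyp_bernoulli2 (2 * int k)
      = ?N * (fps_nth ?F (2 * k) * fps_nth ?F (2 * n - 2 * k))" if "k \<le> n" for k
  proof -
    have "hyp_bernoulli2 (2 * int n - 2 * int k) = fact (2 * n - 2 * k) * fps_nth ?F (2 * n - 2 * k)"
      using B[of "2 * n - 2 * k"] that by (simp add: of_nat_diff)
    moreover have "hyp_bernoulli2 (2 * int k) = fact (2 * k) * fps_nth ?F (2 * k)"
      using B[of "2 * k"] by simp
    moreover have "real ((2 * n) choose (2 * k)) = ?N / (fact (2 * k) * fact (2 * n - 2 * k))"
      using that by (intro binomial_fact) simp
    ultimately show ?thesis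
      by simp
  qed
  have "(\<Sum>k=0..n. real ((2 * n) choose (2 * k))
            * hyp_bernoulli2 (2 * int n - 2 * int k) * hyp_bernoulli2 (2 * int k))
      = ?N * (\<Sum>k=0..n. fps_nth ?F (2 * k) * fps_nth ?F (2 * n - 2 * k))"
    by (simp add: term_eq sum_distrib_left)
  also have "\<dots> = ?N / 2 * fps_nth (?F * ?F + (?F oo - fps_X) * ?F) (2 * n)"
    by (simp only: fps_nth_even_convolution)
  also have "fps_nth (?F * ?F + (?F oo - fps_X) * ?F) (2 * n) =
      kdelta (2 * int n - 2) / 4 + (2 - real n) * fps_nth ?F (2 * n)
        + (if n = 0 then 0 else fps_nth ?F (2 * n - 1) / 2)"
  proof -
    have "fps_nth (fps_X ^ 2 :: real fps) (2 * n) = kdelta (2 * int n - 2)"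
      by (auto simp: fps_X_power_nth kdelta_def)
    moreover have "fps_nth (fps_X * fps_deriv ?F) (2 * n) = 2 * real n * fps_nth ?F (2 * n)"
      by (cases n) simp_all
    moreover have "fps_nth (fps_X * ?F) (2 * n) = (if n = 0 then 0 else fps_nth ?F (2 * n - 1))"
      by simp
    moreover have "fps_nth (fps_X * (?F oo - fps_X)) (2 * n) =
        - (if n = 0 then 0 else fps_nth ?F (2 * n - 1))"
      by (cases n) (simp_all add: fps_compose_uminus')
    moreover have "fps_nth (?F oo - fps_X) (2 * n) = fps_nth ?F (2 * n)"
      by (simp add: fps_compose_uminus')
    ultimately show ?thesis
      unfolding hyp_bernoulli2_gf_square hyp_bernoulli2_gf_mult_reflect
      by (simp only: fps_add_nth fps_sub_nth fps_mult_left_const_nth) (simp add: field_simps)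
  qed
  also have "?N / 2 * \<dots> = 1/4 * (kdelta (2 * int n - 2)
                + 2 * real n * hyp_bernoulli2 (2 * int n - 1)
                - (2 * real n - 4) * hyp_bernoulli2 (2 * int n))"
  proof -
    have "?N * kdelta (2 * int n - 2) = 2 * kdelta (2 * int n - 2)"
      by (cases "n = 1") (auto simp: kdelta_def fact_numeral)
    moreover have "hyp_bernoulli2 (2 * int n) = ?N * fps_nth ?F (2 * n)"
      using B[of "2 * n"] by simp
    moreover have "2 * real n * hyp_bernoulli2 (2 * int n - 1) =
        (if n = 0 then 0 else ?N * fps_nth ?F (2 * n - 1))"
    proof (cases n)
      case (Suc m)
      then have "2 * int n - 1 = int (2 * n - 1)" and "2 * n = Suc (2 * n - 1)"
        by simp_all
      then show ?thesis
        using B[of "2 * n - 1"] fact_Suc[of "2 * n - 1", where 'a = real] Suc by simp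
    qed simp
    ultimately show ?thesis
      by (cases "n = 0") (simp_all add: kdelta_def algebra_simps)
  qed
  finally show ?thesis .
qed

end
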